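(* Let $n$ be a positive integer and $A\in W^{n-1,q}(D,\mathbb{B})$ with $q>2$. Every $f\in V^n_{A,0}(D,\mathbb{B})$ is representable as $$f=\sum_{k=0}^{n-1}\widehat{z^*}^{\,k}\,\varphi_k,$$ where $\varphi_k\in H_{A,0}(D,\mathbb{B})$ for each $k$.
   Context: $D$ is the open unit disk in $\mathbb{C}$. For $u=x+iy\in\mathbb{C}$, $u^*=x-iy$. $\mathbb{B}$ denotes the bicomplex numbers: the commutative $\mathbb{C}$-algebra of elements $z_1+jz_2$ with $z_1,z_2\in\mathbb{C}$, $j^2=-1$, $ij=ji$. The bicomplexification of $u=x+iy$ is $\widehat u=x+jy\in\mathbb{B}$; thus $\widehat{z^*}=x-jy$ for $z=x+iy$. $W^{n-1,q}(D,\mathbb{B})$ is the Sobolev space of $\mathbb{B}$-valued functions on $D$ whose components are in the usual Sobolev space $W^{n-1,q}(D)$ (with $W^{0,q}=L^q$). $\bar\partial=\frac12(\partial_x+j\partial_y)$. $H_{A,0}(D,\mathbb{B})$ is the set of $f:D\to\mathbb{B}$ with $\bar\partial f=Af$. $V^n_{A,0}(D,\mathbb{B})$ is the set of $f:D\to\mathbb{B}$ with $(\bar\partial-A)^nf=0$, where $A$ acts by multiplication. Derivatives are understood in the weak sense, the iterates $(\bar\partial-A)^kf$, $0\le k\le n$, being locally integrable functions obtained successively. *)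

theory Defs
  imports "HOL-Analysis.Analysis"
begin

section \<open>Bicomplex numbers\<close>

text \<open>\<open>Bicomplex z1 z2\<close> stands for \<open>z1 + j z2\<close>; see \<open>Bicomplex_eq\<close> below.\<close>

datatype bicomplex = Bicomplex (bc1: complex) (bc2: complex)

lemma bicomplex_eq_iff: "x = y \<longleftrightarrow> bc1 x = bc1 y \<and> bc2 x = bc2 y"
  by (cases x; cases y) simp

instantiation bicomplex :: comm_ring_1
begin

definition zero_bicomplex :: bicomplex where "0 = Bicomplex 0 0"
definition one_bicomplex :: bicomplex where "1 = Bicomplex 1 0"
definition plus_bicomplex :: "bicomplex \<Rightarrow> bicomplex \<Rightarrow> bicomplex" where
  "x + y = Bicomplex (bc1 x + bc1 y) (bc2 x + bc2 y)"
definition uminus_bicomplex :: "bicomplex \<Rightarrow> bicomplex" where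
  "- x = Bicomplex (- bc1 x) (- bc2 x)"
definition minus_bicomplex :: "bicomplex \<Rightarrow> bicomplex \<Rightarrow> bicomplex" where
  "x - y = Bicomplex (bc1 x - bc1 y) (bc2 x - bc2 y)"
definition times_bicomplex :: "bicomplex \<Rightarrow> bicomplex \<Rightarrow> bicomplex" where
  "x * y = Bicomplex (bc1 x * bc1 y - bc2 x * bc2 y) (bc1 x * bc2 y + bc2 x * bc1 y)"

lemmas bicomplex_ring_defs =
  zero_bicomplex_def one_bicomplex_def plus_bicomplex_def uminus_bicomplex_def
  minus_bicomplex_def times_bicomplex_def

instance
  by standard (simp_all add: bicomplex_eq_iff bicomplex_ring_defs algebra_simps)

end

lemma bc_simps [simp]:
  "bc1 0 = 0" "bc2 0 = 0" "bc1 1 = 1" "bc2 1 = 0"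
  "bc1 (x + y) = bc1 x + bc1 y" "bc2 (x + y) = bc2 x + bc2 y"
  "bc1 (- x) = - bc1 x" "bc2 (- x) = - bc2 x"
  "bc1 (x - y) = bc1 x - bc1 y" "bc2 (x - y) = bc2 x - bc2 y"
  "bc1 (x * y) = bc1 x * bc1 y - bc2 x * bc2 y"
  "bc2 (x * y) = bc1 x * bc2 y + bc2 x * bc1 y"
  by (simp_all add: bicomplex_ring_defs)

instantiation bicomplex :: real_algebra_1
begin

definition scaleR_bicomplex :: "real \<Rightarrow> bicomplex \<Rightarrow> bicomplex" where
  "r *\<^sub>R x = Bicomplex (r *\<^sub>R bc1 x) (r *\<^sub>R bc2 x)"

instance
  by standard (simp_all add: bicomplex_eq_iff scaleR_bicomplex_def algebra_simps)

end

lemma bc_scaleR [simp]: "bc1 (r *\<^sub>R x) = r *\<^sub>R bc1 x" "bc2 (r *\<^sub>R x) = r *\<^sub>R bc2 x"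
  by (simp_all add: scaleR_bicomplex_def)

text \<open>The Euclidean structure of \<open>\<complex> \<times> \<complex>\<close>. It only serves to supply integration and local
  integrability for bicomplex functions, for which any equivalent norm would do; the
  Euclidean norm is not submultiplicative, so this is not a normed algebra in the
  sense of \<open>real_normed_algebra\<close>.\<close>

instantiation bicomplex :: real_inner
begin

definition inner_bicomplex :: "bicomplex \<Rightarrow> bicomplex \<Rightarrow> real" where
  "inner x y = inner (bc1 x) (bc1 y) + inner (bc2 x) (bc2 y)"
definition norm_bicomplex :: "bicomplex \<Rightarrow> real" where
  "norm (x :: bicomplex) = sqrt (inner x x)"
definition sgn_bicomplex :: "bicomplex \<Rightarrow> bicomplex" where
  "sgn x = x /\<^sub>R norm (x :: bicomplex)"
definition dist_bicomplex :: "bicomplex \<Rightarrow> bicomplex \<Rightarrow> real" where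
  "dist x y = norm (x - y :: bicomplex)"
definition uniformity_bicomplex :: "(bicomplex \<times> bicomplex) filter" where
  "uniformity = (INF e\<in>{0 <..}. principal {(x :: bicomplex, y). dist x y < e})"
definition open_bicomplex :: "bicomplex set \<Rightarrow> bool" where
  "open (U :: bicomplex set) \<longleftrightarrow>
     (\<forall>x\<in>U. eventually (\<lambda>(x', y). x' = x \<longrightarrow> y \<in> U) uniformity)"

instance
proof
  fix x y z :: bicomplex and a :: real
  show "inner x y = inner y x"
    by (simp add: inner_bicomplex_def inner_commute)
  show "inner (x + y) z = inner x z + inner y z"
    by (simp add: inner_bicomplex_def inner_add_left)
  show "inner (a *\<^sub>R x) y = a * inner x y"
    by (simp add: inner_bicomplex_def scaleR_bicomplex_def distrib_left)
  show "0 \<le> inner x x"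
    by (simp add: inner_bicomplex_def)
  show "inner x x = 0 \<longleftrightarrow> x = 0"
    by (simp add: inner_bicomplex_def bicomplex_eq_iff add_nonneg_eq_0_iff)
qed (rule dist_bicomplex_def sgn_bicomplex_def uniformity_bicomplex_def
      open_bicomplex_def norm_bicomplex_def)+

end

instantiation bicomplex :: euclidean_space
begin

definition Basis_bicomplex :: "bicomplex set" where
  "Basis = (\<lambda>b. Bicomplex b 0) ` Basis \<union> (\<lambda>b. Bicomplex 0 b) ` Basis"

instance
proof
  show "(Basis :: bicomplex set) \<noteq> {}" "finite (Basis :: bicomplex set)"
    by (simp_all add: Basis_bicomplex_def)
next
  fix u v :: bicomplex
  assume "u \<in> Basis" "v \<in> Basis"
  then show "inner u v = (if u = v then 1 else 0)"
    by (auto simp: Basis_bicomplex_def inner_bicomplex_def inner_Basis split: if_splits)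
next
  fix x :: bicomplex
  show "(\<forall>u\<in>Basis. inner x u = 0) \<longleftrightarrow> x = 0"
    by (auto simp: Basis_bicomplex_def inner_bicomplex_def ball_Un bicomplex_eq_iff
        complex_eq_iff Basis_complex_def)
qed

end

definition of_complex :: "complex \<Rightarrow> bicomplex" where
  "of_complex z = Bicomplex z 0"

definition bc_j :: bicomplex where
  "bc_j = Bicomplex 0 1"

lemma bc_j_squared: "bc_j * bc_j = - 1"
  by (simp add: bc_j_def bicomplex_eq_iff)

lemma Bicomplex_eq: "Bicomplex z1 z2 = of_complex z1 + bc_j * of_complex z2"
  by (simp add: bc_j_def of_complex_def bicomplex_eq_iff)

definition bihat :: "complex \<Rightarrow> bicomplex" where
  "bihat u = of_real (Re u) + bc_j * of_real (Im u)"


section \<open>Test functions and weak derivatives\<close>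

text \<open>The plane is the type \<open>complex\<close>; \<open>\<partial>\<^sub>x\<close> and \<open>\<partial>\<^sub>y\<close> are the directional
  derivatives along \<open>1\<close> and \<open>\<i>\<close>.\<close>

definition dx :: "(complex \<Rightarrow> real) \<Rightarrow> complex \<Rightarrow> real" where
  "dx \<phi> z = frechet_derivative \<phi> (at z) 1"

definition dy :: "(complex \<Rightarrow> real) \<Rightarrow> complex \<Rightarrow> real" where
  "dy \<phi> z = frechet_derivative \<phi> (at z) \<i>"

text \<open>\<open>C_diff k \<phi>\<close>: all iterated partial derivatives of order below \<open>k\<close> are
  differentiable, those of order at most \<open>k\<close> are continuous.\<close>

fun C_diff :: "nat \<Rightarrow> (complex \<Rightarrow> real) \<Rightarrow> bool" where
  "C_diff 0 \<phi> \<longleftrightarrow> continuous_on UNIV \<phi>"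
| "C_diff (Suc k) \<phi> \<longleftrightarrow>
     (\<forall>z. \<phi> differentiable (at z)) \<and> C_diff k (dx \<phi>) \<and> C_diff k (dy \<phi>)"

definition test_fun :: "complex set \<Rightarrow> (complex \<Rightarrow> real) \<Rightarrow> bool" where
  "test_fun \<Omega> \<phi> \<longleftrightarrow> (\<forall>k. C_diff k \<phi>) \<and>
     compact (closure {z. \<phi> z \<noteq> 0}) \<and> closure {z. \<phi> z \<noteq> 0} \<subseteq> \<Omega>"

definition loc_integrable :: "complex set \<Rightarrow> (complex \<Rightarrow> 'a::euclidean_space) \<Rightarrow> bool" where
  "loc_integrable \<Omega> f \<longleftrightarrow> (\<forall>K. compact K \<and> K \<subseteq> \<Omega> \<longrightarrow> f absolutely_integrable_on K)"

definition has_weak_deriv ::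
  "complex set \<Rightarrow> nat \<Rightarrow> nat \<Rightarrow> (complex \<Rightarrow> 'a::euclidean_space) \<Rightarrow> (complex \<Rightarrow> 'a) \<Rightarrow> bool" where
  "has_weak_deriv \<Omega> a b f g \<longleftrightarrow> loc_integrable \<Omega> f \<and> loc_integrable \<Omega> g \<and>
     (\<forall>\<phi>. test_fun \<Omega> \<phi> \<longrightarrow>
        (LINT z:\<Omega>|lebesgue. (dx ^^ a) ((dy ^^ b) \<phi>) z *\<^sub>R f z) =
        (- 1) ^ (a + b) *\<^sub>R (LINT z:\<Omega>|lebesgue. \<phi> z *\<^sub>R g z))"

definition Lspace :: "real \<Rightarrow> complex set \<Rightarrow> (complex \<Rightarrow> 'a::euclidean_space) set" where
  "Lspace q \<Omega> = {f. f \<in> borel_measurable (lebesgue_on \<Omega>) \<and>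
     integrable (lebesgue_on \<Omega>) (\<lambda>z. norm (f z) powr q)}"

definition Sobolev :: "nat \<Rightarrow> real \<Rightarrow> complex set \<Rightarrow> (complex \<Rightarrow> 'a::euclidean_space) set" where
  "Sobolev m q \<Omega> = {f \<in> Lspace q \<Omega>.
     \<forall>a b. a + b \<le> m \<longrightarrow> (\<exists>g \<in> Lspace q \<Omega>. has_weak_deriv \<Omega> a b f g)}"

definition Sobolev_bc :: "nat \<Rightarrow> real \<Rightarrow> complex set \<Rightarrow> (complex \<Rightarrow> bicomplex) set" where
  "Sobolev_bc m q \<Omega> =
     {A. (\<lambda>z. bc1 (A z)) \<in> Sobolev m q \<Omega> \<and> (\<lambda>z. bc2 (A z)) \<in> Sobolev m q \<Omega>}"


section \<open>The weak operator \<open>\<partial>bar - A\<close>\<close>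

definition dbar_test :: "(complex \<Rightarrow> real) \<Rightarrow> complex \<Rightarrow> bicomplex" where
  "dbar_test \<phi> z = (1 / 2) *\<^sub>R (of_real (dx \<phi> z) + bc_j * of_real (dy \<phi> z))"

text \<open>The locally integrable function \<open>h\<close> is the distribution \<open>\<partial>bar f\<close>. As \<open>\<partial>bar\<close> has
  constant coefficients, its formal transpose is \<open>- \<partial>bar\<close>. No separate local
  integrability of the weak \<open>x\<close>- and \<open>y\<close>-derivatives is asked for.\<close>

definition has_weak_dbar ::
  "complex set \<Rightarrow> (complex \<Rightarrow> bicomplex) \<Rightarrow> (complex \<Rightarrow> bicomplex) \<Rightarrow> bool" where
  "has_weak_dbar \<Omega> f h \<longleftrightarrow> loc_integrable \<Omega> f \<and> loc_integrable \<Omega> h \<and>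
     (\<forall>\<phi>. test_fun \<Omega> \<phi> \<longrightarrow>
        (LINT z:\<Omega>|lebesgue. f z * dbar_test \<phi> z) =
        - (LINT z:\<Omega>|lebesgue. \<phi> z *\<^sub>R h z))"

text \<open>\<open>g = (\<partial>bar - A) f\<close>. Local integrability of \<open>A f = \<partial>bar f - g\<close> is implied.\<close>

definition weak_dbar_minus :: "complex set \<Rightarrow> (complex \<Rightarrow> bicomplex) \<Rightarrow>
    (complex \<Rightarrow> bicomplex) \<Rightarrow> (complex \<Rightarrow> bicomplex) \<Rightarrow> bool" where
  "weak_dbar_minus \<Omega> A f g \<longleftrightarrow> loc_integrable \<Omega> g \<and>
     (\<exists>h. has_weak_dbar \<Omega> f h \<and> (AE z\<in>\<Omega> in lebesgue. g z = h z - A z * f z))"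

definition H_space :: "(complex \<Rightarrow> bicomplex) \<Rightarrow> complex set \<Rightarrow> (complex \<Rightarrow> bicomplex) set" where
  "H_space A \<Omega> = {f. has_weak_dbar \<Omega> f (\<lambda>z. A z * f z)}"

text \<open>\<open>g k\<close> is the iterate \<open>(\<partial>bar - A)\<^sup>k f\<close>.\<close>

definition V_space ::
  "nat \<Rightarrow> (complex \<Rightarrow> bicomplex) \<Rightarrow> complex set \<Rightarrow> (complex \<Rightarrow> bicomplex) set" where
  "V_space n A \<Omega> = {f. \<exists>g :: nat \<Rightarrow> complex \<Rightarrow> bicomplex. g 0 = f \<and>
     (\<forall>k\<le>n. loc_integrable \<Omega> (g k)) \<and>
     (\<forall>k<n. weak_dbar_minus \<Omega> A (g k) (g (Suc k))) \<and>
     (AE z\<in>\<Omega> in lebesgue. g n z = 0)}"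

abbreviation unit_disk :: "complex set" where
  "unit_disk \<equiv> ball 0 1"

end

theory Submission
  imports Defs
begin

text \<open>
  Write \<open>w\<close> for the function \<open>z \<mapsto> bihat (cnj z)\<close>, that is \<open>x - j y\<close>, and \<open>T\<close> for the
  weak operator \<open>\<partial>bar - A\<close>. Since \<open>j\<^sup>2 = - 1\<close>, \<open>\<partial>bar w = 1\<close>, so the Leibniz rule reads
  \<open>T (w f) = f + w T f\<close>: multiplication by \<open>w\<close> behaves like the variable with respect to
  which \<open>T\<close> differentiates, and the kernel of \<open>T\<close> plays the role of the constants. The
  representation is then the Taylor formula that expresses a polynomial of degree below \<open>n\<close>
  through its coefficients at the origin, where each coefficient is computed by a Taylor
  expansion about the point \<open>w\<close>, evaluated at the origin:
  \<open>\<phi>\<^sub>k = (1 / k!) \<Sum>m<n-k. ((-w)\<^sup>m / m!) T\<^bsup>k+m\<^esup> f\<close>.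

  Applying \<open>T\<close> to this sum produces a telescope in which only a multiple of \<open>T\<^sup>n f = 0\<close>
  survives (\<open>weak_dbar_minus_taylor_sum\<close>), so \<open>\<phi>\<^sub>k\<close> lies in the kernel of \<open>T\<close>. In
  \<open>\<Sum>k<n. w\<^sup>k \<phi>\<^sub>k\<close> the coefficient of \<open>w\<^sup>l T\<^sup>l f\<close> is \<open>(1 - 1)\<^sup>l / l!\<close>, which leaves only
  the term \<open>f\<close> (\<open>taylor_resummation\<close>); this part is a pointwise identity.

  The only analytic ingredient is the Leibniz rule for weak derivatives
  (\<open>has_weak_dbar_bihat_cnj_mult\<close>). Both components of \<open>w\<close> are linear functions, and a linear
  function times a test function is again a test function, so the factor \<open>w\<close> can be moved
  from \<open>f\<close> onto the test function.
\<close>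

section \<open>Bicomplex multiplication\<close>

text \<open>The Euclidean norm on \<^typ>\<open>bicomplex\<close> is not submultiplicative; that multiplication is
  nevertheless bounded, and hence continuous, comes from finite dimension.\<close>

lemma bounded_bilinear_bicomplex_mult:
  "bounded_bilinear ((*) :: bicomplex \<Rightarrow> bicomplex \<Rightarrow> bicomplex)"
  unfolding bilinear_conv_bounded_bilinear [symmetric] bilinear_def
  by (auto intro!: linearI simp: algebra_simps)

lemmas continuous_on_bicomplex_mult [continuous_intros] =
  bounded_bilinear.continuous_on [OF bounded_bilinear_bicomplex_mult]

lemma continuous_on_bicomplex_power [continuous_intros]:
  fixes f :: "'a::topological_space \<Rightarrow> bicomplex"
  assumes "continuous_on S f"
  shows "continuous_on S (\<lambda>x. f x ^ m)"
  by (induction m) (auto intro!: continuous_intros assms)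

lemma continuous_on_bicomplex_of_real [continuous_intros]:
  assumes "continuous_on S f"
  shows "continuous_on S (\<lambda>x. of_real (f x) :: bicomplex)"
  unfolding of_real_def by (intro continuous_intros assms)

lemma continuous_on_bihat [continuous_intros]:
  assumes "continuous_on S f"
  shows "continuous_on S (\<lambda>x. bihat (f x))"
  unfolding bihat_def by (intro continuous_intros assms)

lemma set_integral_bicomplex_mult_right:
  fixes f :: "'a \<Rightarrow> bicomplex"
  assumes "set_integrable M S f"
  shows "set_integrable M S (\<lambda>x. c * f x)"
    and "(LINT x:S|M. c * f x) = c * (LINT x:S|M. f x)"
proof -
  have bl: "bounded_linear (\<lambda>x::bicomplex. c * x)"
    by (rule bounded_bilinear.bounded_linear_right [OF bounded_bilinear_bicomplex_mult])
  have eq: "indicator S x *\<^sub>R (c * f x) = c * (indicator S x *\<^sub>R f x)" for x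
    by simp
  show "set_integrable M S (\<lambda>x. c * f x)"
    using assms unfolding set_integrable_def eq by (rule integrable_bounded_linear [OF bl])
  show "(LINT x:S|M. c * f x) = c * (LINT x:S|M. f x)"
    using assms unfolding set_integrable_def set_lebesgue_integral_def eq
    by (rule integral_bounded_linear [OF bl])
qed

section \<open>Local integrability\<close>

lemma loc_integrable_add:
  "loc_integrable \<Omega> f \<Longrightarrow> loc_integrable \<Omega> g \<Longrightarrow> loc_integrable \<Omega> (\<lambda>z. f z + g z)"
  unfolding loc_integrable_def by (auto intro: set_integral_add(1))

lemma loc_integrable_scaleR:
  "loc_integrable \<Omega> f \<Longrightarrow> loc_integrable \<Omega> (\<lambda>z. r *\<^sub>R f z)"
  unfolding loc_integrable_def by (auto intro: absolutely_integrable_scaleR_left)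

lemma absolutely_integrable_continuous_bicomplex_mult:
  fixes f :: "complex \<Rightarrow> bicomplex"
  assumes "compact K" "continuous_on K c" "f absolutely_integrable_on K"
  shows "(\<lambda>z. c z * f z) absolutely_integrable_on K"
proof (rule absolutely_integrable_bounded_measurable_product [where h = "(*)"])
  show "bilinear ((*) :: bicomplex \<Rightarrow> bicomplex \<Rightarrow> bicomplex)"
    by (simp add: bilinear_conv_bounded_bilinear bounded_bilinear_bicomplex_mult)
  show K: "K \<in> sets lebesgue"
    using assms(1) by (simp add: lmeasurable_compact fmeasurableD)
  show "c \<in> borel_measurable (lebesgue_on K)"
    using assms(2) K by (rule continuous_imp_measurable_on_sets_lebesgue)
  show "bounded (c ` K)"
    using assms(1,2) by (simp add: compact_imp_bounded compact_continuous_image)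
qed (rule assms)

lemma loc_integrable_continuous_mult:
  fixes f :: "complex \<Rightarrow> bicomplex"
  assumes "continuous_on \<Omega> c" "loc_integrable \<Omega> f"
  shows "loc_integrable \<Omega> (\<lambda>z. c z * f z)"
  using assms unfolding loc_integrable_def
  by (auto intro!: absolutely_integrable_continuous_bicomplex_mult
      elim: continuous_on_subset)

text \<open>Changing a function on a null set of \<open>\<Omega>\<close> preserves measurability because Lebesgue
  measure is complete.\<close>

lemma loc_integrable_cong_AE:
  assumes "loc_integrable \<Omega> f" "AE z\<in>\<Omega> in lebesgue. f z = g z"
  shows "loc_integrable \<Omega> g"
  unfolding loc_integrable_def
proof (intro allI impI)
  fix K assume K: "compact K \<and> K \<subseteq> \<Omega>"
  have "negligible {z. \<not> (z \<in> \<Omega> \<longrightarrow> f z = g z)}"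
    using assms(2) by (simp add: eventually_ae_filter_negligible negligible_iff_null_sets)
      (meson completion.complete2 negligible_iff_null_sets negligible_subset)
  moreover have "g z = f z" if "z \<in> K - {z. \<not> (z \<in> \<Omega> \<longrightarrow> f z = g z)}" for z
    using that K by auto
  moreover have "f absolutely_integrable_on K"
    using assms(1) K by (simp add: loc_integrable_def)
  ultimately show "g absolutely_integrable_on K"
    by (intro absolutely_integrable_spike [where g = g])
qed

text \<open>A compactly supported continuous factor turns local integrability into integrability over all
  of \<open>\<Omega>\<close>. This is what makes the integrals in the definition of the weak derivative additive,
  since the integral of a non-integrable function is \<open>0\<close> by default.\<close>

lemma set_integrable_compact_support_mult:
  fixes f :: "complex \<Rightarrow> bicomplex"
  assumes f: "loc_integrable \<Omega> f" and K: "compact K" "K \<subseteq> \<Omega>"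
    and c: "continuous_on UNIV c" "\<And>z. z \<notin> K \<Longrightarrow> c z = 0"
  shows "set_integrable lebesgue \<Omega> (\<lambda>z. c z * f z)"
proof -
  have "(\<lambda>z. c z * f z) absolutely_integrable_on K"
    using f K c by (intro absolutely_integrable_continuous_bicomplex_mult)
      (auto simp: loc_integrable_def elim: continuous_on_subset)
  moreover have "(\<lambda>z. indicat_real \<Omega> z *\<^sub>R (c z * f z)) = (\<lambda>z. indicat_real K z *\<^sub>R (c z * f z))"
    using K c(2) by (auto simp: indicator_def fun_eq_iff)
  ultimately show ?thesis
    unfolding set_integrable_def by simp
qed

section \<open>Test functions\<close>

lemma C_diff_SucD: "C_diff (Suc k) \<phi> \<Longrightarrow> C_diff k \<phi>"
proof (induction k arbitrary: \<phi>)
  case 0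
  then show ?case
    by (auto simp: continuous_on_eq_continuous_at differentiable_imp_continuous_within)
next
  case (Suc k)
  then show ?case using C_diff.simps(2) by blast
qed

lemma dx_dy_eq:
  assumes "(\<phi> has_derivative D) (at z)"
  shows "dx \<phi> z = D 1" and "dy \<phi> z = D \<i>"
  using frechet_derivative_at [OF assms] by (simp_all add: dx_def dy_def)

lemma dx_dy_add:
  assumes "\<phi> differentiable at z" "\<psi> differentiable at z"
  shows "dx (\<lambda>z. \<phi> z + \<psi> z) z = dx \<phi> z + dx \<psi> z"
    and "dy (\<lambda>z. \<phi> z + \<psi> z) z = dy \<phi> z + dy \<psi> z"
proof -
  have "((\<lambda>z. \<phi> z + \<psi> z) has_derivative
      (\<lambda>h. frechet_derivative \<phi> (at z) h + frechet_derivative \<psi> (at z) h)) (at z)"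
    using assms by (intro has_derivative_add) (rule frechet_derivative_works [THEN iffD1], assumption)+
  then show "dx (\<lambda>z. \<phi> z + \<psi> z) z = dx \<phi> z + dx \<psi> z"
    and "dy (\<lambda>z. \<phi> z + \<psi> z) z = dy \<phi> z + dy \<psi> z"
    by (simp_all add: dx_dy_eq) (simp_all add: dx_def dy_def)
qed

lemma C_diff_add: "C_diff k \<phi> \<Longrightarrow> C_diff k \<psi> \<Longrightarrow> C_diff k (\<lambda>z. \<phi> z + \<psi> z)"
proof (induction k arbitrary: \<phi> \<psi>)
  case 0
  then show ?case by (auto intro: continuous_intros)
next
  case (Suc k)
  then have "dx (\<lambda>z. \<phi> z + \<psi> z) = (\<lambda>z. dx \<phi> z + dx \<psi> z)"
    "dy (\<lambda>z. \<phi> z + \<psi> z) = (\<lambda>z. dy \<phi> z + dy \<psi> z)"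
    by (auto simp: dx_dy_add)
  with Suc show ?case by auto
qed

lemma C_diff_scale: "C_diff k \<phi> \<Longrightarrow> C_diff k (\<lambda>z. c * \<phi> z)"
proof (induction k arbitrary: \<phi>)
  case 0
  then show ?case by (auto intro: continuous_intros)
next
  case (Suc k)
  then have d: "\<phi> differentiable at z" for z by simp
  have D: "((\<lambda>z. c * \<phi> z) has_derivative (\<lambda>h. c * frechet_derivative \<phi> (at z) h)) (at z)" for z
    using d by (intro has_derivative_mult_right) (rule frechet_derivative_works [THEN iffD1])
  have "dx (\<lambda>z. c * \<phi> z) = (\<lambda>z. c * dx \<phi> z)" "dy (\<lambda>z. c * \<phi> z) = (\<lambda>z. c * dy \<phi> z)"
    by (auto simp: fun_eq_iff dx_dy_eq [OF D]) (auto simp: dx_def dy_def)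
  with Suc d show ?case by (auto intro: differentiable_mult)
qed

lemma dx_dy_linear_mult:
  assumes L: "bounded_linear L" and d: "\<phi> differentiable at z"
  shows "dx (\<lambda>z. L z * \<phi> z) z = L 1 * \<phi> z + L z * dx \<phi> z"
    and "dy (\<lambda>z. L z * \<phi> z) z = L \<i> * \<phi> z + L z * dy \<phi> z"
proof -
  have "((\<lambda>z. L z * \<phi> z) has_derivative
      (\<lambda>h. L z * frechet_derivative \<phi> (at z) h + L h * \<phi> z)) (at z)"
    using d by (intro has_derivative_mult bounded_linear_imp_has_derivative [OF L])
      (rule frechet_derivative_works [THEN iffD1])
  then show "dx (\<lambda>z. L z * \<phi> z) z = L 1 * \<phi> z + L z * dx \<phi> z"
    and "dy (\<lambda>z. L z * \<phi> z) z = L \<i> * \<phi> z + L z * dy \<phi> z"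
    by (simp_all add: dx_dy_eq) (simp_all add: dx_def dy_def)
qed

text \<open>The derivative of a linear \<open>L\<close> is constant, so differentiating \<open>L \<phi>\<close> gives a multiple of
  \<open>\<phi>\<close> plus \<open>L\<close> times a derivative of \<open>\<phi>\<close>. The induction therefore closes on sums and on
  products with the same \<open>L\<close>.\<close>

lemma C_diff_linear_mult:
  assumes L: "bounded_linear L"
  shows "C_diff k \<phi> \<Longrightarrow> C_diff k (\<lambda>z. L z * \<phi> z)"
proof (induction k arbitrary: \<phi>)
  case 0
  then show ?case
    unfolding C_diff.simps by (rule continuous_on_mult [OF linear_continuous_on [OF L]])
next
  case (Suc k)
  then have d: "\<phi> differentiable at z" for z by simp
  have eq: "dx (\<lambda>z. L z * \<phi> z) = (\<lambda>z. L 1 * \<phi> z + L z * dx \<phi> z)"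
    "dy (\<lambda>z. L z * \<phi> z) = (\<lambda>z. L \<i> * \<phi> z + L z * dy \<phi> z)"
    using d by (auto simp: dx_dy_linear_mult [OF L])
  have "(\<lambda>z. L z * \<phi> z) differentiable at z" for z
    using bounded_linear_imp_differentiable [OF L] d by (rule differentiable_mult)
  moreover have "C_diff k \<phi>" using Suc.prems by (rule C_diff_SucD)
  ultimately show ?case
    using Suc unfolding C_diff.simps eq by (auto intro!: C_diff_add C_diff_scale)
qed

lemma test_fun_linear_mult:
  assumes L: "bounded_linear L" and \<phi>: "test_fun \<Omega> \<phi>"
  shows "test_fun \<Omega> (\<lambda>z. L z * \<phi> z)"
proof -
  \<comment> \<open>Multiplication can only shrink the support.\<close>
  have sub: "closure {z. L z * \<phi> z \<noteq> 0} \<subseteq> closure {z. \<phi> z \<noteq> 0}"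
    by (rule closure_mono) auto
  moreover have "compact (closure {z. L z * \<phi> z \<noteq> 0})"
    using \<phi> by (intro compact_closure [THEN iffD2]
        bounded_subset [OF _ closure_subset [THEN subset_trans, OF sub]])
      (auto simp: test_fun_def compact_imp_bounded)
  ultimately show ?thesis
    using \<phi> by (auto simp: test_fun_def C_diff_linear_mult [OF L])
qed

lemma test_fun_differentiable: "test_fun \<Omega> \<phi> \<Longrightarrow> \<phi> differentiable at z"
  unfolding test_fun_def using C_diff.simps(2) by blast

lemma test_fun_continuous:
  assumes "test_fun \<Omega> \<phi>"
  shows "continuous_on UNIV \<phi>" "continuous_on UNIV (dx \<phi>)" "continuous_on UNIV (dy \<phi>)"
proof -
  have "C_diff 0 \<phi>" "C_diff (Suc 0) \<phi>"
    using assms unfolding test_fun_def by blast+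
  then show "continuous_on UNIV \<phi>" "continuous_on UNIV (dx \<phi>)" "continuous_on UNIV (dy \<phi>)"
    by simp_all
qed

lemma dbar_test_eq_0:
  assumes "z \<notin> closure {z. \<phi> z \<noteq> 0}"
  shows "dbar_test \<phi> z = 0"
proof -
  have "((\<lambda>_. 0) has_derivative (\<lambda>_. 0)) (at z)" by simp
  then have "(\<phi> has_derivative (\<lambda>_. 0)) (at z)"
    by (rule has_derivative_transform_within_open [where s = "- closure {z. \<phi> z \<noteq> 0}"])
      (use assms closure_subset [of "{z. \<phi> z \<noteq> 0}"] in \<open>auto simp: open_Compl\<close>)
  then show ?thesis by (simp add: dbar_test_def dx_dy_eq)
qed

lemma set_integrable_test_fun:
  assumes "test_fun \<Omega> \<phi>" "loc_integrable \<Omega> (f :: complex \<Rightarrow> bicomplex)"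
  shows "set_integrable lebesgue \<Omega> (\<lambda>z. \<phi> z *\<^sub>R f z)"
    and "set_integrable lebesgue \<Omega> (\<lambda>z. f z * dbar_test \<phi> z)"
proof -
  let ?K = "closure {z. \<phi> z \<noteq> 0}"
  have K: "compact ?K" "?K \<subseteq> \<Omega>"
    using assms(1) by (auto simp: test_fun_def)
  have "set_integrable lebesgue \<Omega> (\<lambda>z. of_real (\<phi> z) * f z)"
    by (rule set_integrable_compact_support_mult [OF assms(2) K])
      (use closure_subset [of "{z. \<phi> z \<noteq> 0}"] test_fun_continuous [OF assms(1)]
        in \<open>auto intro!: continuous_intros\<close>)
  then show "set_integrable lebesgue \<Omega> (\<lambda>z. \<phi> z *\<^sub>R f z)"
    by (simp add: of_real_def)
  have "continuous_on UNIV (dbar_test \<phi>)"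
    unfolding dbar_test_def [abs_def]
    by (intro continuous_intros test_fun_continuous [OF assms(1)])
  then have "set_integrable lebesgue \<Omega> (\<lambda>z. dbar_test \<phi> z * f z)"
    by (intro set_integrable_compact_support_mult [OF assms(2) K] dbar_test_eq_0)
  then show "set_integrable lebesgue \<Omega> (\<lambda>z. f z * dbar_test \<phi> z)"
    by (simp add: mult.commute)
qed

section \<open>The weak operator and its Leibniz rule\<close>

lemma has_weak_dbar_add:
  assumes "has_weak_dbar \<Omega> f h" "has_weak_dbar \<Omega> f' h'"
  shows "has_weak_dbar \<Omega> (\<lambda>z. f z + f' z) (\<lambda>z. h z + h' z)"
  using assms unfolding has_weak_dbar_def
  by (auto simp: loc_integrable_add distrib_right scaleR_add_right set_integrable_test_fun)

lemma has_weak_dbar_scaleR: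
  assumes "has_weak_dbar \<Omega> f h"
  shows "has_weak_dbar \<Omega> (\<lambda>z. r *\<^sub>R f z) (\<lambda>z. r *\<^sub>R h z)"
  using assms unfolding has_weak_dbar_def
  by (auto simp: loc_integrable_scaleR scaleR_left_commute [of _ r] simp del: scaleR_scaleR)

text \<open>The function \<open>h'\<close> inherits local integrability from \<open>h\<close>. In this way the product \<open>A f\<close>
  becomes locally integrable once it agrees almost everywhere with a weak derivative of \<open>f\<close>.\<close>

lemma has_weak_dbar_cong_AE:
  assumes h: "has_weak_dbar \<Omega> f h" and eq: "AE z\<in>\<Omega> in lebesgue. h z = h' z"
  shows "has_weak_dbar \<Omega> f h'"
  unfolding has_weak_dbar_def
proof (intro conjI allI impI)
  show "loc_integrable \<Omega> f" using h by (simp add: has_weak_dbar_def)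
  show h': "loc_integrable \<Omega> h'"
    using h eq loc_integrable_cong_AE by (auto simp: has_weak_dbar_def)
  fix \<phi> assume \<phi>: "test_fun \<Omega> \<phi>"
  have "(LINT z:\<Omega>|lebesgue. \<phi> z *\<^sub>R h z) = (LINT z:\<Omega>|lebesgue. \<phi> z *\<^sub>R h' z)"
    unfolding set_lebesgue_integral_def
  proof (rule integral_cong_AE)
    show "(\<lambda>z. indicat_real \<Omega> z *\<^sub>R \<phi> z *\<^sub>R h z) \<in> borel_measurable lebesgue"
      using set_integrable_test_fun(1) [OF \<phi>, of h] h
      unfolding has_weak_dbar_def set_integrable_def by (blast dest: borel_measurable_integrable)
    show "(\<lambda>z. indicat_real \<Omega> z *\<^sub>R \<phi> z *\<^sub>R h' z) \<in> borel_measurable lebesgue"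
      using set_integrable_test_fun(1) [OF \<phi> h'] unfolding set_integrable_def
      by (rule borel_measurable_integrable)
    show "AE z in lebesgue. indicat_real \<Omega> z *\<^sub>R \<phi> z *\<^sub>R h z = indicat_real \<Omega> z *\<^sub>R \<phi> z *\<^sub>R h' z"
      using eq by eventually_elim (auto simp: indicator_def)
  qed
  then show "(LINT z:\<Omega>|lebesgue. f z * dbar_test \<phi> z) = - (LINT z:\<Omega>|lebesgue. \<phi> z *\<^sub>R h' z)"
    using h \<phi> by (simp add: has_weak_dbar_def)
qed

text \<open>The classical product rule for \<open>\<partial>bar (w \<phi>)\<close>, rearranged and split into components because test
  functions are real-valued; the last term is \<open>(\<partial>bar w) \<phi> = \<phi>\<close>.\<close>

lemma mult_dbar_test:
  assumes "\<phi> differentiable at z"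
  shows "bihat (cnj z) * dbar_test \<phi> z =
    dbar_test (\<lambda>z. Re z * \<phi> z) z - bc_j * dbar_test (\<lambda>z. Im z * \<phi> z) z - of_real (\<phi> z)"
  using assms
  by (simp add: dbar_test_def dx_dy_linear_mult bounded_linear_Re bounded_linear_Im bihat_def
      bicomplex_eq_iff bc_j_def of_real_def algebra_simps complex_eq_iff)

text \<open>The weak Leibniz rule \<open>\<partial>bar (w f) = f + w \<partial>bar f\<close>: in the integral of \<open>w f \<partial>bar \<phi>\<close>, the identity
  \<open>mult_dbar_test\<close> moves \<open>w\<close> onto the test function, so that the hypothesis applies to the
  test functions \<open>Re z * \<phi> z\<close> and \<open>Im z * \<phi> z\<close>.\<close>

lemma has_weak_dbar_bihat_cnj_mult:
  assumes h: "has_weak_dbar \<Omega> f h"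
  shows "has_weak_dbar \<Omega> (\<lambda>z. bihat (cnj z) * f z) (\<lambda>z. f z + bihat (cnj z) * h z)"
  unfolding has_weak_dbar_def
proof (intro conjI allI impI)
  have lf: "loc_integrable \<Omega> f" and lh: "loc_integrable \<Omega> h"
    using h by (auto simp: has_weak_dbar_def)
  show "loc_integrable \<Omega> (\<lambda>z. bihat (cnj z) * f z)"
    by (intro loc_integrable_continuous_mult lf continuous_intros)
  show "loc_integrable \<Omega> (\<lambda>z. f z + bihat (cnj z) * h z)"
    by (intro loc_integrable_add loc_integrable_continuous_mult lf lh continuous_intros)
  fix \<phi> assume \<phi>: "test_fun \<Omega> \<phi>"
  let ?P = "\<lambda>z. Re z * \<phi> z" and ?Q = "\<lambda>z. Im z * \<phi> z"
  have P: "test_fun \<Omega> ?P" and Q: "test_fun \<Omega> ?Q"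
    using \<phi> by (auto intro!: test_fun_linear_mult bounded_linear_Re bounded_linear_Im)
  note int = set_integrable_test_fun [OF \<phi>] set_integrable_test_fun [OF P]
    set_integrable_test_fun [OF Q] set_integral_bicomplex_mult_right set_integral_diff
    lf lh
  have "(LINT z:\<Omega>|lebesgue. bihat (cnj z) * f z * dbar_test \<phi> z) =
      (LINT z:\<Omega>|lebesgue. f z * dbar_test ?P z - bc_j * (f z * dbar_test ?Q z) - \<phi> z *\<^sub>R f z)"
  proof (rule arg_cong [where f = "set_lebesgue_integral lebesgue \<Omega>"], rule ext)
    fix z
    have "bihat (cnj z) * f z * dbar_test \<phi> z = f z * (bihat (cnj z) * dbar_test \<phi> z)"
      by (simp add: ac_simps)
    then show "bihat (cnj z) * f z * dbar_test \<phi> z =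
        f z * dbar_test ?P z - bc_j * (f z * dbar_test ?Q z) - \<phi> z *\<^sub>R f z"
      by (simp add: mult_dbar_test [OF test_fun_differentiable [OF \<phi>]] right_diff_distrib
          of_real_def mult.left_commute)
  qed
  also have "\<dots> = (LINT z:\<Omega>|lebesgue. f z * dbar_test ?P z)
      - bc_j * (LINT z:\<Omega>|lebesgue. f z * dbar_test ?Q z) - (LINT z:\<Omega>|lebesgue. \<phi> z *\<^sub>R f z)"
    by (simp add: int)
  also have "\<dots> = - (LINT z:\<Omega>|lebesgue. ?P z *\<^sub>R h z)
      + bc_j * (LINT z:\<Omega>|lebesgue. ?Q z *\<^sub>R h z) - (LINT z:\<Omega>|lebesgue. \<phi> z *\<^sub>R f z)"
    using h P Q by (simp add: has_weak_dbar_def)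
  also have "\<dots> = - (LINT z:\<Omega>|lebesgue. \<phi> z *\<^sub>R f z + (?P z *\<^sub>R h z - bc_j * (?Q z *\<^sub>R h z)))"
    by (simp add: int del: mult_scaleR_right scaleR_scaleR)
  also have "(\<lambda>z. \<phi> z *\<^sub>R f z + (?P z *\<^sub>R h z - bc_j * (?Q z *\<^sub>R h z))) =
      (\<lambda>z. \<phi> z *\<^sub>R (f z + bihat (cnj z) * h z))"
    by (auto simp: bihat_def bicomplex_eq_iff bc_j_def of_real_def algebra_simps complex_eq_iff)
  finally show "(LINT z:\<Omega>|lebesgue. bihat (cnj z) * f z * dbar_test \<phi> z) =
      - (LINT z:\<Omega>|lebesgue. \<phi> z *\<^sub>R (f z + bihat (cnj z) * h z))" .
qed

lemma weak_dbar_minus_add: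
  assumes "weak_dbar_minus \<Omega> A f g" "weak_dbar_minus \<Omega> A f' g'"
  shows "weak_dbar_minus \<Omega> A (\<lambda>z. f z + f' z) (\<lambda>z. g z + g' z)"
proof -
  obtain h h' where h: "has_weak_dbar \<Omega> f h" "AE z\<in>\<Omega> in lebesgue. g z = h z - A z * f z"
    and h': "has_weak_dbar \<Omega> f' h'" "AE z\<in>\<Omega> in lebesgue. g' z = h' z - A z * f' z"
    using assms by (auto simp: weak_dbar_minus_def)
  have "AE z\<in>\<Omega> in lebesgue. g z + g' z = (h z + h' z) - A z * (f z + f' z)"
    using h(2) h'(2) by eventually_elim
      (simp add: right_diff_distrib distrib_left mult.left_commute scaleR_diff_right)
  then show ?thesis
    using has_weak_dbar_add [OF h(1) h'(1)] assms loc_integrable_add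
    unfolding weak_dbar_minus_def by blast
qed

lemma weak_dbar_minus_scaleR:
  assumes "weak_dbar_minus \<Omega> A f g"
  shows "weak_dbar_minus \<Omega> A (\<lambda>z. r *\<^sub>R f z) (\<lambda>z. r *\<^sub>R g z)"
proof -
  obtain h where h: "has_weak_dbar \<Omega> f h" "AE z\<in>\<Omega> in lebesgue. g z = h z - A z * f z"
    using assms by (auto simp: weak_dbar_minus_def)
  have "AE z\<in>\<Omega> in lebesgue. r *\<^sub>R g z = r *\<^sub>R h z - A z * (r *\<^sub>R f z)"
    using h(2) by eventually_elim
      (simp add: right_diff_distrib distrib_left mult.left_commute scaleR_diff_right)
  then show ?thesis
    using has_weak_dbar_scaleR [OF h(1)] assms loc_integrable_scaleR
    unfolding weak_dbar_minus_def by blast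
qed

text \<open>Multiplication by \<open>A\<close> commutes with multiplication by \<open>w\<close>, so the Leibniz rule passes from
  \<open>\<partial>bar\<close> to \<open>\<partial>bar - A\<close>.\<close>

lemma weak_dbar_minus_bihat_cnj_mult:
  assumes "weak_dbar_minus \<Omega> A f g"
  shows "weak_dbar_minus \<Omega> A (\<lambda>z. bihat (cnj z) * f z) (\<lambda>z. f z + bihat (cnj z) * g z)"
proof -
  obtain h where h: "has_weak_dbar \<Omega> f h" "AE z\<in>\<Omega> in lebesgue. g z = h z - A z * f z"
    and g: "loc_integrable \<Omega> g"
    using assms by (auto simp: weak_dbar_minus_def)
  have "AE z\<in>\<Omega> in lebesgue. f z + bihat (cnj z) * g z =
      (f z + bihat (cnj z) * h z) - A z * (bihat (cnj z) * f z)"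
    using h(2) by eventually_elim
      (simp add: right_diff_distrib distrib_left mult.left_commute scaleR_diff_right)
  moreover have "loc_integrable \<Omega> (\<lambda>z. f z + bihat (cnj z) * g z)"
    using h g by (intro loc_integrable_add loc_integrable_continuous_mult continuous_intros)
      (auto simp: has_weak_dbar_def)
  ultimately show ?thesis
    using has_weak_dbar_bihat_cnj_mult [OF h(1)] unfolding weak_dbar_minus_def by blast
qed

lemma weak_dbar_minus_bihat_cnj_power_mult:
  assumes "weak_dbar_minus \<Omega> A f g"
  shows "weak_dbar_minus \<Omega> A (\<lambda>z. bihat (cnj z) ^ Suc m * f z)
    (\<lambda>z. real (Suc m) *\<^sub>R (bihat (cnj z) ^ m * f z) + bihat (cnj z) ^ Suc m * g z)"
proof (induction m)
  case 0
  then show ?case using weak_dbar_minus_bihat_cnj_mult [OF assms] by simp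
next
  case (Suc m)
  show ?case
    using weak_dbar_minus_bihat_cnj_mult [OF Suc]
    by (simp add: of_nat_Suc [of "Suc m"] scaleR_add_left distrib_left ac_simps del: of_nat_Suc)
qed

lemma weak_dbar_minus_zero_imp_H_space:
  assumes "weak_dbar_minus \<Omega> A f g" "AE z\<in>\<Omega> in lebesgue. g z = 0"
  shows "f \<in> H_space A \<Omega>"
proof -
  obtain h where h: "has_weak_dbar \<Omega> f h" "AE z\<in>\<Omega> in lebesgue. g z = h z - A z * f z"
    using assms by (auto simp: weak_dbar_minus_def)
  have "AE z\<in>\<Omega> in lebesgue. h z = A z * f z"
    using h(2) assms(2) by eventually_elim auto
  then show ?thesis
    using has_weak_dbar_cong_AE [OF h(1)] by (simp add: H_space_def)
qed

section \<open>Taylor components of a solution\<close>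

text \<open>The factor \<open>1 / k!\<close> common to all terms of the \<open>k\<close>-th component is left out, so that
  \<open>\<partial>bar - A\<close> maps terms of index \<open>k\<close> to differences of terms of index \<open>Suc k\<close>.\<close>

definition taylor_term :: "(nat \<Rightarrow> complex \<Rightarrow> bicomplex) \<Rightarrow> nat \<Rightarrow> nat \<Rightarrow> complex \<Rightarrow> bicomplex" where
  "taylor_term g k m z = ((- 1) ^ m / fact m) *\<^sub>R (bihat (cnj z) ^ m * g (k + m) z)"

text \<open>By the Leibniz rule, \<open>\<partial>bar - A\<close> sends \<open>taylor_term g k m\<close> to
  \<open>taylor_term g (Suc k) m - taylor_term g (Suc k) (m - 1)\<close> (without the second term if \<open>m = 0\<close>),
  and these differences telescope.\<close>

lemma weak_dbar_minus_taylor_sum: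
  assumes "\<And>i. i < n \<Longrightarrow> weak_dbar_minus \<Omega> A (g i) (g (Suc i))"
  shows "k + M < n \<Longrightarrow>
    weak_dbar_minus \<Omega> A (\<lambda>z. \<Sum>m\<le>M. taylor_term g k m z) (taylor_term g (Suc k) M)"
proof (induction M)
  case 0
  then show ?case using assms [of k] by (simp add: taylor_term_def [abs_def])
next
  case (Suc M)
  let ?c = "(- 1) ^ Suc M / fact (Suc M) :: real"
  have "?c * real (Suc M) = - ((- 1) ^ M / fact M)"
    by (simp add: divide_simps)
  then have "?c *\<^sub>R (real (Suc M) *\<^sub>R x) = - (((- 1) ^ M / fact M) *\<^sub>R x)" for x :: bicomplex
    by (simp only: scaleR_scaleR scaleR_minus_left)
  then have "(\<lambda>z. ?c *\<^sub>R (real (Suc M) *\<^sub>R (bihat (cnj z) ^ M * g (k + Suc M) z)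
        + bihat (cnj z) ^ Suc M * g (Suc (k + Suc M)) z)) =
      (\<lambda>z. taylor_term g (Suc k) (Suc M) z - taylor_term g (Suc k) M z)"
    unfolding scaleR_add_right by (simp add: taylor_term_def fun_eq_iff)
  moreover have "weak_dbar_minus \<Omega> A (taylor_term g k (Suc M)) (\<lambda>z. ?c *\<^sub>R (real (Suc M) *\<^sub>R
      (bihat (cnj z) ^ M * g (k + Suc M) z) + bihat (cnj z) ^ Suc M * g (Suc (k + Suc M)) z))"
    unfolding taylor_term_def [abs_def]
    by (intro weak_dbar_minus_scaleR weak_dbar_minus_bihat_cnj_power_mult assms Suc.prems)
  ultimately have "weak_dbar_minus \<Omega> A (taylor_term g k (Suc M))
      (\<lambda>z. taylor_term g (Suc k) (Suc M) z - taylor_term g (Suc k) M z)"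
    by simp
  from weak_dbar_minus_add [OF Suc.IH this] Suc.prems show ?case
    by simp
qed

text \<open>The coefficient of \<open>t\<^sup>l\<close> in \<open>exp t * exp (- t) = 1\<close>.\<close>

lemma alternating_inverse_fact_sum:
  "(\<Sum>i\<le>l. (- 1) ^ (l - i) / (fact i * fact (l - i))) = (if l = 0 then 1 else 0 :: real)"
proof -
  have "(\<Sum>i\<le>l. (- 1) ^ (l - i) / (fact i * fact (l - i)) :: real) =
      (\<Sum>i\<le>l. of_nat (l choose i) * 1 ^ i * (- 1) ^ (l - i)) / fact l"
    unfolding sum_divide_distrib
    by (intro sum.cong) (auto simp: binomial_fact field_simps)
  also have "\<dots> = (1 + - 1) ^ l / fact l"
    unfolding binomial_ring ..
  finally show ?thesis by (cases l) auto
qed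

text \<open>Collecting the terms with \<open>k + m = l\<close> gives the power \<open>w\<^sup>l\<close> and the iterate \<open>g l\<close> with the
  coefficient \<open>alternating_inverse_fact_sum\<close>, which vanishes unless \<open>l = 0\<close>.\<close>

lemma taylor_resummation:
  assumes "n > 0"
  shows "(\<Sum>k<n. bihat (cnj z) ^ k * ((1 / fact k) *\<^sub>R (\<Sum>m\<le>n - Suc k. taylor_term g k m z))) = g 0 z"
proof -
  let ?w = "bihat (cnj z)"
  let ?F = "\<lambda>k m. ((- 1) ^ m / (fact k * fact m)) *\<^sub>R (?w ^ (k + m) * g (k + m) z)"
  have "(\<Sum>k<n. ?w ^ k * ((1 / fact k) *\<^sub>R (\<Sum>m\<le>n - Suc k. taylor_term g k m z))) =
      (\<Sum>k<n. \<Sum>m<n - k. ?F k m)"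
  proof (rule sum.cong [OF refl])
    fix k assume "k \<in> {..<n}"
    then have "{..n - Suc k} = {..<n - k}" by auto
    then show "?w ^ k * ((1 / fact k) *\<^sub>R (\<Sum>m\<le>n - Suc k. taylor_term g k m z)) =
        (\<Sum>m<n - k. ?F k m)"
      by (simp add: taylor_term_def scaleR_sum_right sum_distrib_left power_add mult.assoc
          divide_simps)
  qed
  also have "\<dots> = (\<Sum>(k, m)\<in>{(k, m). k + m < n}. ?F k m)"
    by (subst sum.Sigma) (auto intro!: sum.cong)
  also have "\<dots> = (\<Sum>l<n. \<Sum>i\<le>l. ?F i (l - i))"
    by (rule sum.triangle_reindex)
  also have "\<dots> = (\<Sum>l<n. if l = 0 then g 0 z else 0)"
  proof (rule sum.cong [OF refl])
    fix l
    have "(\<Sum>i\<le>l. ?F i (l - i)) =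
        (\<Sum>i\<le>l. (- 1) ^ (l - i) / (fact i * fact (l - i))) *\<^sub>R (?w ^ l * g l z)"
      by (simp add: scaleR_sum_left)
    then show "(\<Sum>i\<le>l. ?F i (l - i)) = (if l = 0 then g 0 z else 0)"
      by (simp add: alternating_inverse_fact_sum)
  qed
  also have "\<dots> = g 0 z"
    using assms by simp
  finally show ?thesis .
qed

theorem theorem6p3:
  fixes n :: nat and q :: real and A f :: "complex \<Rightarrow> bicomplex"
  assumes "n > 0" and "q > 2"
    and "A \<in> Sobolev_bc (n - 1) q unit_disk"
    and "f \<in> V_space n A unit_disk"
  shows "\<exists>\<phi> :: nat \<Rightarrow> complex \<Rightarrow> bicomplex.
    (\<forall>k<n. \<phi> k \<in> H_space A unit_disk) \<and>
    (AE z\<in>unit_disk in lebesgue. f z = (\<Sum>k<n. bihat (cnj z) ^ k * \<phi> k z))"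
proof -
  obtain g where g0: "g 0 = f"
    and step: "\<And>k. k < n \<Longrightarrow> weak_dbar_minus unit_disk A (g k) (g (Suc k))"
    and gn: "AE z\<in>unit_disk in lebesgue. g n z = 0"
    using assms(4) by (auto simp: V_space_def)
  define \<phi> where "\<phi> k z = (1 / fact k) *\<^sub>R (\<Sum>m\<le>n - Suc k. taylor_term g k m z)" for k z
  have "\<phi> k \<in> H_space A unit_disk" if "k < n" for k
  proof (rule weak_dbar_minus_zero_imp_H_space)
    show "weak_dbar_minus unit_disk A (\<phi> k)
        (\<lambda>z. (1 / fact k) *\<^sub>R taylor_term g (Suc k) (n - Suc k) z)"
      unfolding \<phi>_def [abs_def] using that
      by (intro weak_dbar_minus_scaleR weak_dbar_minus_taylor_sum [where n = n] step) auto
    \<comment> \<open>The surviving term contains the iterate of index \<open>Suc k + (n - Suc k) = n\<close>.\<close>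
    show "AE z\<in>unit_disk in lebesgue.
        (1 / fact k) *\<^sub>R taylor_term g (Suc k) (n - Suc k) z = 0"
      using gn by eventually_elim (use that in \<open>simp add: taylor_term_def\<close>)
  qed
  moreover have "f z = (\<Sum>k<n. bihat (cnj z) ^ k * \<phi> k z)" for z
    using taylor_resummation [OF assms(1), of z g] by (simp add: \<phi>_def g0)
  ultimately show ?thesis by blast
qed

end
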